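(* Let $\delta\in(0,1]$, $\epsilon\in(0,1]$, let $q$ be an integer with $2<q<\infty$, and let $Z_0$ be any initial color configuration. Let $\mu$ be any subsequential limit distribution of the $q$-color process $Z_n$ with parameters $(\delta,\epsilon)$ started from $Z_0$, i.e. any probability measure on $\{1,\dots,q\}^{\mathbb{Z}}$ that is the weak limit of the laws of $Z_{n_k}$ along some sequence $n_k\to\infty$. Then $\mu$ is color permutation invariant: for every permutation $\sigma$ of $\{1,\dots,q\}$, $\mu$ is invariant under the map $(z_j)_{j\in\mathbb{Z}}\mapsto(\sigma(z_j))_{j\in\mathbb{Z}}$.
   Context: Let $V=\{(x,t)\in\mathbb{Z}^2 : x+t \text{ even}\}$, and let $\delta,\epsilon\in[0,1]$. Let $(X(v))_{v\in V}$ be i.i.d. with values in the set of symbols $\{\nwarrow,\ \nearrow,\ \nwarrow\nearrow,\ \odot\}$ and $$P(X(v)=\nwarrow)=P(X(v)=\nearrow)=\tfrac12(1-\delta),\quad P(X(v)=\nwarrow\nearrow)=\delta(1-\epsilon),\quad P(X(v)=\odot)=\delta\epsilon .$$ For $v=(x,t)$ write $v_l=(x-1,t+1)$ and $v_r=(x+1,t+1)$. Let $(Y(v))_{v\in V}$ be i.i.d. uniform on the set of colors $\{1,\dots,q\}$, independent of the $X(v)$'s. Row $n$ ($n\ge 0$) is the set of vertices $(x,-n)\in V$, so time $n$ runs downwards. The colors $Z(v)$ for $v$ in row $0$ are given by the initial configuration $Z_0$. For $v$ in row $n\ge1$, $$Z(v)=\begin{cases} Z(v_l) & \text{if } X(v)=\nwarrow,\\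 Z(v_r) & \text{if } X(v)=\nearrow,\\ Z(v_l) & \text{if } X(v)=\nwarrow\nearrow \text{ and } Z(v_l)=Z(v_r),\\ Y(v) & \text{if } X(v)=\odot, \text{ or } X(v)=\nwarrow\nearrow \text{ and } Z(v_l)\ne Z(v_r).\end{cases}$$ $Z_n$ denotes the sequence of colors of the vertices of row $n$. Row $n$ is identified with $\mathbb{Z}$ via $(x,-n)\mapsto (x+n)/2$, so that $Z_n$ is a time-homogeneous discrete-time Markov process on $\{1,\dots,q\}^{\mathbb{Z}}$ with the product topology. *)

theory Defs
  imports "HOL-Probability.Probability" "HOL-Combinatorics.Permutations"
begin

definition vertices :: "(int \<times> int) set" where
  "vertices = {(x, t). even (x + t)}"

text \<open>\<open>NWNE\<close> is the double arrow, \<open>Odot\<close> the circled dot.\<close>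

datatype symbol = NW | NE | NWNE | Odot

locale symbols_and_colors = prob_space M
  for M :: "'w measure" +
  fixes X :: "int \<times> int \<Rightarrow> 'w \<Rightarrow> symbol"
    and Y :: "int \<times> int \<Rightarrow> 'w \<Rightarrow> nat"
    and \<delta> \<epsilon> :: real
    and q :: nat
  assumes indep_X: "indep_vars (\<lambda>_. count_space UNIV) X vertices"
    and prob_NW: "v \<in> vertices \<Longrightarrow> prob {\<omega> \<in> space M. X v \<omega> = NW} = (1 - \<delta>) / 2"
    and prob_NE: "v \<in> vertices \<Longrightarrow> prob {\<omega> \<in> space M. X v \<omega> = NE} = (1 - \<delta>) / 2"
    and prob_NWNE: "v \<in> vertices \<Longrightarrow> prob {\<omega> \<in> space M. X v \<omega> = NWNE} = \<delta> * (1 - \<epsilon>)"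
    and prob_Odot: "v \<in> vertices \<Longrightarrow> prob {\<omega> \<in> space M. X v \<omega> = Odot} = \<delta> * \<epsilon>"
    and indep_Y: "indep_vars (\<lambda>_. count_space {1..q}) Y vertices"
    and distr_Y: "v \<in> vertices \<Longrightarrow>
      distr M (count_space {1..q}) (Y v) = uniform_count_measure {1..q}"
    and indep_X_Y: "indep_set
      {(\<lambda>\<omega>. \<lambda>v\<in>vertices. X v \<omega>) -` A \<inter> space M |A.
        A \<in> sets (PiM vertices (\<lambda>_. count_space UNIV))}
      {(\<lambda>\<omega>. \<lambda>v\<in>vertices. Y v \<omega>) -` B \<inter> space M |B.
        B \<in> sets (PiM vertices (\<lambda>_. count_space {1..q}))}"
      \<comment> \<open>\<open>indep_var\<close> would force both families to take values in the same type\<close>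

text \<open>
  \<open>row_color a y z0 n x\<close> is the color of the vertex \<open>(x, - n)\<close>; it is meaningful only when
  \<open>x - n\<close> is even. The vertex \<open>(x, 0)\<close> of row 0 carries the index \<open>x div 2\<close>.
\<close>

primrec row_color ::
  "(int \<times> int \<Rightarrow> symbol) \<Rightarrow> (int \<times> int \<Rightarrow> nat) \<Rightarrow> (int \<Rightarrow> nat) \<Rightarrow> nat \<Rightarrow> int \<Rightarrow> nat"
where
  "row_color a y z0 0 x = z0 (x div 2)"
| "row_color a y z0 (Suc n) x =
    (let v = (x, - int (Suc n));
         l = row_color a y z0 n (x - 1);
         r = row_color a y z0 n (x + 1)
     in case a v of
          NW \<Rightarrow> l
        | NE \<Rightarrow> r
        | NWNE \<Rightarrow> (if l = r then l else y v)
        | Odot \<Rightarrow> y v)"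

text \<open>The position \<open>j\<close> of row \<open>n\<close> is the vertex with \<open>j = (x + n) / 2\<close>, that is
  \<open>x = 2 * j - n\<close>.\<close>

definition color_process ::
  "(int \<times> int \<Rightarrow> 'w \<Rightarrow> symbol) \<Rightarrow> (int \<times> int \<Rightarrow> 'w \<Rightarrow> nat) \<Rightarrow> (int \<Rightarrow> nat)
    \<Rightarrow> nat \<Rightarrow> 'w \<Rightarrow> int \<Rightarrow> nat"
where
  "color_process X Y z0 n \<omega> =
    (\<lambda>j. row_color (\<lambda>v. X v \<omega>) (\<lambda>v. Y v \<omega>) z0 n (2 * j - int n))"

definition configs :: "nat \<Rightarrow> (int \<Rightarrow> nat) set" where
  "configs q = UNIV \<rightarrow> {1..q}"

text \<open>The topology of the function type is the product topology, \<open>nat\<close> being discrete, so its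
  trace on \<open>configs q\<close> is the product topology of \<open>{1..q}\<close> over all integers.\<close>

definition config_space :: "nat \<Rightarrow> (int \<Rightarrow> nat) measure" where
  "config_space q = restrict_space borel (configs q)"

text \<open>Weak convergence of measures on the Borel sets of the subspace \<open>S\<close>.\<close>

definition weak_conv_on ::
  "'a::topological_space set \<Rightarrow> (nat \<Rightarrow> 'a measure) \<Rightarrow> 'a measure \<Rightarrow> bool"
where
  "weak_conv_on S N \<mu> \<longleftrightarrow>
    (\<forall>f :: 'a \<Rightarrow> real. continuous_on S f \<and> bounded (f ` S) \<longrightarrow>
      (\<lambda>k. \<integral>z. f z \<partial>N k) \<longlonglongrightarrow> (\<integral>z. f z \<partial>\<mu>))"

definition subseq_limit_law ::
  "nat \<Rightarrow> 'w measure \<Rightarrow> (nat \<Rightarrow> 'w \<Rightarrow> int \<Rightarrow> nat) \<Rightarrow> (int \<Rightarrow> nat) measure \<Rightarrow> bool"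
where
  "subseq_limit_law q M Z \<mu> \<longleftrightarrow>
    prob_space \<mu> \<and> sets \<mu> = sets (config_space q) \<and>
    (\<exists>r :: nat \<Rightarrow> nat. filterlim r at_top sequentially \<and>
      weak_conv_on (configs q) (\<lambda>k. distr M (config_space q) (Z (r k))) \<mu>)"

definition color_permutation_invariant :: "nat \<Rightarrow> (int \<Rightarrow> nat) measure \<Rightarrow> bool" where
  "color_permutation_invariant q \<mu> \<longleftrightarrow>
    (\<forall>\<sigma>. \<sigma> permutes {1..q} \<longrightarrow> distr \<mu> \<mu> (\<lambda>z j. \<sigma> (z j)) = \<mu>)"

end

theory Submission imports Defs begin

text \<open>
  Identify the colors with \<open>\<int>/q\<close> and let \<open>\<chi>\<close> be a nontrivial character. A fresh uniform color has
  \<open>\<chi>\<close>-expectation \<open>0\<close>, and \<open>q\<close> times the indicator of \<open>l = r\<close> is the sum of \<open>\<psi>(l) \<psi>(r)\<inverse>\<close> over all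
  characters \<open>\<psi>\<close>. Hence, given the row above, the expectation of \<open>\<chi>\<close> at a vertex is a combination of
  characters of the two upper neighbors with nonnegative coefficients of total mass \<open>1 - \<delta> \<epsilon>\<close>. The
  same formula holds after applying a permutation \<open>\<sigma>\<close> to all colors. As the vertices of a row are
  conditionally independent, by induction on \<open>n\<close> the expectations of a finite product of
  characters under the laws of \<open>Z\<^sub>n\<close> and \<open>\<sigma> Z\<^sub>n\<close> differ by at most \<open>2 (1 - \<delta> \<epsilon>)\<^sup>n\<close>, uniformly in the
  product. Indicators of cylinder sets are finite combinations of such products.
\<close>

section \<open>Characters of color configurations\<close>

text \<open>Colors are read modulo \<open>q\<close>, with the color \<open>q\<close> in the role of
  0. The frequency \<open>a\<close> may be any integer, so that expressions such as
  \<open>a - int b\<close> need no reduction.\<close>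

definition color_char :: "nat \<Rightarrow> int \<Rightarrow> nat \<Rightarrow> complex" where
  "color_char q a c = cis (2 * pi * of_int a * of_nat c / of_nat q)"

lemma color_char_0 [simp]: "color_char q 0 c = 1"
  by (simp add: color_char_def)

lemma norm_color_char [simp]: "norm (color_char q a c) = 1"
  by (simp add: color_char_def)

lemma color_char_add: "color_char q (a + b) c = color_char q a c * color_char q b c"
  by (simp add: color_char_def cis_mult algebra_simps add_divide_distrib)

lemma color_char_power: "color_char q a c = cis (2 * pi * of_int a / of_nat q) ^ c"
  by (simp add: color_char_def Complex.DeMoivre algebra_simps)

lemma cis_eq_1_iff_dvd:
  assumes "q > 0"
  shows "cis (2 * pi * of_int a / of_nat q) = 1 \<longleftrightarrow> int q dvd a"
proof
  assume "int q dvd a"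
  then obtain k where "a = int q * k" by auto
  then have "2 * pi * of_int a / of_nat q = 2 * pi * of_int k"
    using assms by simp
  then show "cis (2 * pi * of_int a / of_nat q) = 1"
    by simp
next
  assume "cis (2 * pi * of_int a / of_nat q) = 1"
  then have "cos (2 * pi * of_int a / of_nat q) = 1"
    by (metis cis.simps(1) one_complex.simps(1))
  then obtain k :: int where "2 * pi * of_int a / of_nat q = of_int k * 2 * pi"
    by (auto simp: cos_one_2pi_int)
  then have "of_int a = (of_int k * of_nat q :: real)"
    using assms by (simp add: field_simps)
  then have "a = k * int q"
    by (metis of_int_eq_iff of_int_mult of_int_of_nat_eq)
  then show "int q dvd a" by simp
qed

lemma color_char_dvd:
  assumes "q > 0" "int q dvd a"
  shows "color_char q a c = 1"
  using cis_eq_1_iff_dvd[OF assms(1), of a] assms(2) by (simp only: color_char_power) simp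

text \<open>A geometric series whose ratio is a \<open>q\<close>-th root of unity; it vanishes
  unless the ratio is 1.\<close>

lemma sum_power_cis:
  assumes "q > 0"
  shows "(\<Sum>k<q. cis (2 * pi * of_int a / of_nat q) ^ k) = (if int q dvd a then of_nat q else 0)"
proof -
  let ?z = "cis (2 * pi * of_int a / of_nat q)"
  have "?z ^ q = 1"
    using assms by (simp add: Complex.DeMoivre)
  then have "?z \<noteq> 1 \<Longrightarrow> (\<Sum>k<q. ?z ^ k) = 0"
    by (simp add: geometric_sum)
  then show ?thesis
    using cis_eq_1_iff_dvd[OF assms, of a] by auto
qed

text \<open>Orthogonality to the trivial character, which makes a fresh uniform color invisible to a
  nontrivial one. Shifting the range from \<open>{1..q}\<close> to \<open>{..<q}\<close> costs only
  a constant factor.\<close>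

lemma sum_color_char_colors:
  assumes "q > 0" "\<not> int q dvd a"
  shows "(\<Sum>c\<in>{1..q}. color_char q a c) = 0"
proof -
  have "(\<Sum>c\<in>{1..q}. color_char q a c) = (\<Sum>k<q. color_char q a (Suc k))"
    using sum.atLeast1_atMost_eq by simp
  also have "\<dots> = cis (2 * pi * of_int a / of_nat q) * (\<Sum>k<q. cis (2 * pi * of_int a / of_nat q) ^ k)"
    by (simp add: color_char_power sum_distrib_left)
  finally show ?thesis
    using sum_power_cis[OF assms(1), of a] assms(2) by simp
qed

text \<open>The summand is \<open>color_char q a r\<close> times the \<open>b\<close>-th power of a
  root of unity with exponent \<open>l - r\<close>, so orthogonality leaves only the case
  \<open>l = r\<close>. This is the Fourier expansion of the double-arrow rule for equal
  neighbors.\<close>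

lemma color_char_delta:
  assumes "l \<in> {1..q}" "r \<in> {1..q}"
  shows "(\<Sum>b<q. color_char q (int b) l * color_char q (a - int b) r) =
    (if l = r then of_nat q * color_char q a r else 0)"
proof -
  have q: "q > 0" using assms by auto
  have *: "color_char q (int b) l * color_char q (a - int b) r =
      color_char q a r * cis (2 * pi * of_int (int l - int r) / of_nat q) ^ b" for b
    by (simp add: color_char_def cis_mult Complex.DeMoivre diff_divide_distrib algebra_simps)
  \<comment> \<open>Two elements of \<open>{1..q}\<close> differ by less than \<open>q\<close>, so
    congruence modulo \<open>q\<close> is equality.\<close>
  have "int q dvd int l - int r \<longleftrightarrow> l = r"
    using assms zdvd_imp_le[of "int q" "int l - int r"] zdvd_imp_le[of "int q" "int r - int l"]
      dvd_diff_commute[of "int q" "int l" "int r"]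
    by (cases l r rule: linorder_cases) auto
  then show ?thesis
    unfolding * sum_distrib_left[symmetric] sum_power_cis[OF q] by simp
qed

definition config_char :: "nat \<Rightarrow> int set \<Rightarrow> (int \<Rightarrow> int) \<Rightarrow> (int \<Rightarrow> nat) \<Rightarrow> complex" where
  "config_char q J a z = (\<Prod>j\<in>J. color_char q (a j) (z j))"

lemma norm_config_char [simp]: "norm (config_char q J a z) = 1"
  by (simp add: config_char_def prod_norm[symmetric])

text \<open>Trivial characters pad the index set, so that two products can be brought over a common
  one.\<close>

lemma config_char_superset:
  assumes "finite K" "J \<subseteq> K"
  shows "config_char q J a = config_char q K (\<lambda>j. if j \<in> J then a j else 0)"
  unfolding config_char_def by (rule ext, rule prod.mono_neutral_cong_left) (use assms in auto)

lemma config_char_mult: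
  assumes "finite J" "finite K"
  shows "config_char q J a z * config_char q K b z =
    config_char q (J \<union> K) (\<lambda>j. (if j \<in> J then a j else 0) + (if j \<in> K then b j else 0)) z"
  unfolding config_char_superset[of "J \<union> K" J q a, OF finite_UnI[OF assms] Un_upper1]
    config_char_superset[of "J \<union> K" K q b, OF finite_UnI[OF assms] Un_upper2]
  by (simp add: config_char_def color_char_add prod.distrib)

section \<open>Functions with a bound on their Fourier coefficients\<close>

text \<open>\<open>w\<close> bounds the sum of the absolute values of the Fourier coefficients of \<open>f\<close>.\<close>

inductive wiener_bound :: "nat \<Rightarrow> real \<Rightarrow> ((int \<Rightarrow> nat) \<Rightarrow> complex) \<Rightarrow> bool" for q where
  char: "finite J \<Longrightarrow> wiener_bound q 1 (config_char q J a)"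
| scale: "wiener_bound q w f \<Longrightarrow> wiener_bound q (norm c * w) (\<lambda>z. c * f z)"
| add: "wiener_bound q w f \<Longrightarrow> wiener_bound q w' g \<Longrightarrow> wiener_bound q (w + w') (\<lambda>z. f z + g z)"

lemma wiener_bound_color_char: "wiener_bound q 1 (\<lambda>z. color_char q a (z j))"
  using wiener_bound.char[of "{j}" q "\<lambda>_. a"] by (simp add: config_char_def[abs_def])

lemma wiener_bound_1: "wiener_bound q 1 (\<lambda>z. 1)"
  using wiener_bound_color_char[of q 0] by simp

lemma wiener_bound_0: "wiener_bound q 0 (\<lambda>z. 0)"
  using wiener_bound.scale[OF wiener_bound_1, where c = 0] by simp

text \<open>The product of two characters is a character, so the bounds multiply as in the Wiener
  algebra. A second induction, on \<open>g\<close>, is needed only when \<open>f\<close> is a single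
  character.\<close>

lemma wiener_bound_mult:
  assumes "wiener_bound q w f" "wiener_bound q w' g"
  shows "wiener_bound q (w * w') (\<lambda>z. f z * g z)"
  using assms(1)
proof induction
  case (char J a)
  from assms(2) show ?case
  proof induction
    case (char K b)
    show ?case
      using wiener_bound.char[of "J \<union> K" q] char \<open>finite J\<close> by (simp add: config_char_mult)
  next
    case (scale w g c)
    from wiener_bound.scale[OF scale.IH, of c] show ?case
      by (simp add: mult_ac)
  next
    case (add w g w' h)
    from wiener_bound.add[OF add.IH] show ?case
      by (simp add: algebra_simps)
  qed
next
  case (scale w f c)
  from wiener_bound.scale[OF scale.IH, of c] show ?case
    by (simp add: mult_ac)
next
  case (add w f v h)
  from wiener_bound.add[OF add.IH] show ?case
    by (simp add: algebra_simps)
qed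

lemma wiener_bound_prod:
  assumes "finite J" "\<And>j. j \<in> J \<Longrightarrow> wiener_bound q (w j) (f j)"
  shows "wiener_bound q (\<Prod>j\<in>J. w j) (\<lambda>z. \<Prod>j\<in>J. f j z)"
  using assms by (induction J rule: finite_induct) (auto intro!: wiener_bound_1 wiener_bound_mult)

lemma wiener_bound_sum:
  assumes "finite J" "\<And>j. j \<in> J \<Longrightarrow> wiener_bound q (w j) (f j)"
  shows "wiener_bound q (\<Sum>j\<in>J. w j) (\<lambda>z. \<Sum>j\<in>J. f j z)"
  using assms by (induction J rule: finite_induct) (auto intro!: wiener_bound_0 wiener_bound.add)

text \<open>Fourier inversion on the integers modulo \<open>q\<close>: the indicator of
  \<open>x = c\<close> is the sum in \<open>color_char_delta\<close> at \<open>a = 0\<close>,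
  divided by \<open>q\<close>. Agreement is restricted to colors because \<open>h\<close> is
  periodic while \<open>g\<close> is arbitrary.\<close>

lemma wiener_bound_coordinate:
  fixes g :: "nat \<Rightarrow> complex"
  obtains w h where "wiener_bound q w (\<lambda>z. h (z j))" "\<And>c. c \<in> {1..q} \<Longrightarrow> h c = g c"
proof
  let ?h = "\<lambda>x. \<Sum>c\<in>{1..q}. \<Sum>b<q. g c / of_nat q * (color_char q (int b) x * color_char q (- int b) c)"
  show "?h c = g c" if "c \<in> {1..q}" for c
  proof -
    have "?h c = (\<Sum>d\<in>{1..q}. g d / of_nat q * (if c = d then of_nat q * color_char q 0 d else 0))"
      unfolding sum_distrib_left[symmetric]
      by (intro sum.cong refl) (use color_char_delta[OF that, of _ 0] in simp)
    also have "\<dots> = (\<Sum>d\<in>{1..q}. if c = d then g d else 0)"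
      by (intro sum.cong) (use that in auto)
    finally show ?thesis
      using that by simp
  qed
  have "wiener_bound q (\<Sum>c\<in>{1..q}. \<Sum>b<q. norm (g c / of_nat q * color_char q (- int b) c) * 1)
    (\<lambda>z. \<Sum>c\<in>{1..q}. \<Sum>b<q. (g c / of_nat q * color_char q (- int b) c) * color_char q (int b) (z j))"
    by (intro wiener_bound_sum wiener_bound.scale wiener_bound_color_char) auto
  then show "wiener_bound q (\<Sum>c\<in>{1..q}. \<Sum>b<q. norm (g c / of_nat q * color_char q (- int b) c) * 1) (\<lambda>z. ?h (z j))"
    by (simp add: mult_ac)
qed

section \<open>The dual transition kernel\<close>

text \<open>The conditional expectation of the character \<open>a\<close> of a color, given the colors \<open>l\<close> and \<open>r\<close>
  of its two upper neighbors; the inner sum is \<open>q * color_char q a l\<close> if \<open>l = r\<close> and \<open>0\<close> otherwise.\<close>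

definition dual_kernel :: "nat \<Rightarrow> real \<Rightarrow> real \<Rightarrow> int \<Rightarrow> nat \<Rightarrow> nat \<Rightarrow> complex" where
  "dual_kernel q \<delta> \<epsilon> a l r =
    (if int q dvd a then 1
     else of_real ((1 - \<delta>) / 2) * color_char q a l + of_real ((1 - \<delta>) / 2) * color_char q a r
       + of_real (\<delta> * (1 - \<epsilon>) / of_nat q) *
         (\<Sum>b<q. color_char q (int b) l * color_char q (a - int b) r))"

text \<open>For a nontrivial character the coefficients are nonnegative with sum \<open>(1 -
  \<delta>) + \<delta> * (1 - \<epsilon>) = 1 - \<delta> * \<epsilon>\<close>; the missing mass is
  the probability of \<open>Odot\<close>.\<close>

lemma wiener_bound_dual_kernel:
  assumes "q > 0" "0 \<le> \<delta>" "\<delta> \<le> 1" "\<epsilon> \<le> 1"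
  shows "wiener_bound q (if int q dvd a then 1 else 1 - \<delta> * \<epsilon>) (\<lambda>z. dual_kernel q \<delta> \<epsilon> a (z i) (z j))"
proof (cases "int q dvd a")
  case True
  then show ?thesis by (simp add: dual_kernel_def wiener_bound_1)
next
  case False
  let ?c = "complex_of_real ((1 - \<delta>) / 2)"
  let ?d = "complex_of_real (\<delta> * (1 - \<epsilon>) / of_nat q)"
  have "wiener_bound q (norm ?c * 1 + norm ?c * 1 + norm ?d * (\<Sum>b<q. 1 * 1))
    (\<lambda>z. ?c * color_char q a (z i) + ?c * color_char q a (z j) +
      ?d * (\<Sum>b<q. color_char q (int b) (z i) * color_char q (a - int b) (z j)))"
    by (intro wiener_bound.add wiener_bound.scale wiener_bound_sum wiener_bound_mult
        wiener_bound_color_char) auto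
  also have "norm ?c * 1 + norm ?c * 1 + norm ?d * (\<Sum>b<q. 1 * 1) = 1 - \<delta> * \<epsilon>"
    using assms mult_nonneg_nonneg[of \<delta> "1 - \<epsilon>"]
    by (simp only: norm_of_real) (simp add: field_simps)
  finally show ?thesis
    using False by (simp add: dual_kernel_def)
qed

section \<open>Independence of the rows\<close>

lemma UNIV_symbol: "(UNIV :: symbol set) = {NW, NE, NWNE, Odot}"
  using symbol.exhaust by auto

instance symbol :: finite
  by standard (simp add: UNIV_symbol)

definition next_color :: "symbol \<Rightarrow> nat \<Rightarrow> nat \<Rightarrow> nat \<Rightarrow> nat" where
  "next_color s y l r =
    (case s of NW \<Rightarrow> l | NE \<Rightarrow> r | NWNE \<Rightarrow> (if l = r then l else y) | Odot \<Rightarrow> y)"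

lemma row_color_Suc:
  "row_color a y z0 (Suc n) x =
    next_color (a (x, - int (Suc n))) (y (x, - int (Suc n)))
      (row_color a y z0 n (x - 1)) (row_color a y z0 n (x + 1))"
  by (simp add: next_color_def Let_def)

definition row_vertex :: "nat \<Rightarrow> int \<Rightarrow> int \<times> int" where
  "row_vertex n j = (2 * j - int n, - int n)"

lemma row_vertex_in_vertices [simp]: "row_vertex n j \<in> vertices"
  by (auto simp: row_vertex_def vertices_def)

lemma color_process_0: "color_process X Y z0 0 \<omega> j = z0 j"
  by (simp add: color_process_def)

text \<open>Position \<open>j\<close> of row \<open>n + 1\<close> has
  \<open>x = 2 * j - n - 1\<close>, so \<open>x - 1\<close> and \<open>x + 1\<close> are the
  positions \<open>j - 1\<close> and \<open>j\<close> of row \<open>n\<close>.\<close>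

lemma color_process_Suc:
  "color_process X Y z0 (Suc n) \<omega> j =
    next_color (X (row_vertex (Suc n) j) \<omega>) (Y (row_vertex (Suc n) j) \<omega>)
      (color_process X Y z0 n \<omega> (j - 1)) (color_process X Y z0 n \<omega> j)"
proof -
  have "2 * j - (1 + int n) - 1 = 2 * (j - 1) - int n" "2 * j - (1 + int n) + 1 = 2 * j - int n"
    by simp_all
  then show ?thesis
    by (simp only: color_process_def row_vertex_def row_color_Suc of_nat_Suc)
qed

text \<open>A half plane that carries all the randomness of the rows up to \<open>n\<close> and is
  disjoint from row \<open>n + 1\<close>; it separates the past from the next step.\<close>

definition upper_vertices :: "nat \<Rightarrow> (int \<times> int) set" where
  "upper_vertices n = {(x, t). even (x + t) \<and> - int n \<le> t}"

lemma row_color_cong: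
  assumes "\<And>v. v \<in> upper_vertices n \<Longrightarrow> a v = a' v \<and> y v = y' v" "m \<le> n" "even (x - int m)"
  shows "row_color a y z0 m x = row_color a' y' z0 m x"
  using assms(2,3)
proof (induction m arbitrary: x)
  case (Suc m)
  have "(x, - int (Suc m)) \<in> upper_vertices n"
    using Suc.prems by (auto simp: upper_vertices_def)
  from assms(1)[OF this]
  show ?case
    using Suc.IH[of "x - 1"] Suc.IH[of "x + 1"] Suc.prems by (simp add: row_color_Suc del: row_color.simps)
qed simp

lemma measurable_row_color:
  assumes "m \<le> n" "even (x - int m)"
  shows "(\<lambda>f. row_color (\<lambda>v. fst (f v)) (\<lambda>v. snd (f v)) z0 m x)
    \<in> measurable (PiM (upper_vertices n) (\<lambda>_. count_space (UNIV :: (symbol \<times> nat) set))) (count_space UNIV)"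
  using assms
proof (induction m arbitrary: x)
  case (Suc m)
  let ?P = "PiM (upper_vertices n) (\<lambda>_. count_space (UNIV :: (symbol \<times> nat) set))"
  let ?v = "(x, - int (Suc m))"
  have "?v \<in> upper_vertices n"
    using Suc.prems by (auto simp: upper_vertices_def)
  then have v: "(\<lambda>f. f ?v) \<in> measurable ?P (count_space UNIV)"
    by (rule measurable_component_singleton)
  have l: "(\<lambda>f. row_color (\<lambda>v. fst (f v)) (\<lambda>v. snd (f v)) z0 m (x - 1)) \<in> measurable ?P (count_space UNIV)"
    and r: "(\<lambda>f. row_color (\<lambda>v. fst (f v)) (\<lambda>v. snd (f v)) z0 m (x + 1)) \<in> measurable ?P (count_space UNIV)"
    using Suc.IH[of "x - 1"] Suc.IH[of "x + 1"] Suc.prems by simp_all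
  \<comment> \<open>Successive case splits on three functions with countable range, namely the pair
    at \<open>?v\<close>, the left color and the right color, leave a constant function.\<close>
  show ?case
    unfolding row_color_Suc
    by (rule measurable_compose_countable[where g = "\<lambda>f. f ?v" and
          f = "\<lambda>w f. next_color (fst w) (snd w) (L f) (R f)" for L R, OF _ v],
        rule measurable_compose_countable[OF _ l, where
          f = "\<lambda>c f. next_color (fst w) (snd w) c (R f)" for w R],
        rule measurable_compose_countable[OF _ r, where
          f = "\<lambda>c f. next_color (fst w) (snd w) d c" for w d])
      simp
qed simp

lemma sets_PiM_cylinder:
  assumes J: "finite J" "J \<noteq> {}" "J \<subseteq> I" and C: "\<And>v. v \<in> J \<Longrightarrow> C v \<in> sets (N v)"
  shows "{f \<in> space (PiM I N). \<forall>v\<in>J. f v \<in> C v} \<in> sets (PiM I N)"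
proof -
  have "(\<lambda>f. f v) -` C v \<inter> space (PiM I N) \<in> sets (PiM I N)" if "v \<in> J" for v
    by (rule measurable_sets[OF measurable_component_singleton[where M = N] C[OF that]]) (use J(3) that in auto)
  then have "(\<Inter>v\<in>J. (\<lambda>f. f v) -` C v \<inter> space (PiM I N)) \<in> sets (PiM I N)"
    using J by (intro sets.finite_INT) auto
  moreover have "(\<Inter>v\<in>J. (\<lambda>f. f v) -` C v \<inter> space (PiM I N)) = {f \<in> space (PiM I N). \<forall>v\<in>J. f v \<in> C v}"
    using J(2) by auto
  ultimately show ?thesis by simp
qed

text \<open>Brings an event about the vertices in \<open>J\<close> into the form of a preimage under
  the whole family, as \<open>indep_X_Y\<close> demands.\<close>

lemma cylinder_vimage:
  assumes J: "J \<noteq> {}" "J \<subseteq> I" and T: "\<And>v. v \<in> I \<Longrightarrow> T v \<in> measurable M (N v)"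
  shows "(\<Inter>v\<in>J. T v -` A v \<inter> space M) =
    (\<lambda>\<omega>. \<lambda>v\<in>I. T v \<omega>) -` {f \<in> space (PiM I N). \<forall>v\<in>J. f v \<in> A v} \<inter> space M"
proof -
  have "(\<lambda>v\<in>I. T v \<omega>) \<in> space (PiM I N)" if "\<omega> \<in> space M" for \<omega>
    using measurable_space[OF T that] by (simp add: space_PiM)
  moreover have "(\<lambda>v\<in>I. T v \<omega>) v = T v \<omega>" if "v \<in> J" for v \<omega>
    using J(2) that by auto
  ultimately show ?thesis
    using J(1) by auto
qed

context symbols_and_colors
begin

lemma measurable_X: "v \<in> vertices \<Longrightarrow> X v \<in> measurable M (count_space UNIV)"
  using indep_X by (auto simp: indep_vars_def)

lemma measurable_Y: "v \<in> vertices \<Longrightarrow> Y v \<in> measurable M (count_space {1..q})"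
  using indep_Y by (auto simp: indep_vars_def)

lemma Y_range: "v \<in> vertices \<Longrightarrow> \<omega> \<in> space M \<Longrightarrow> Y v \<omega> \<in> {1..q}"
  using measurable_space[OF measurable_Y] by simp

lemma q_pos: "q > 0"
proof -
  obtain \<omega> where "\<omega> \<in> space M" using not_empty by auto
  from Y_range[OF row_vertex_in_vertices this, of 0 0] show ?thesis by auto
qed

text \<open>First the two families are separated as wholes by \<open>indep_X_Y\<close>, then each
  family is factored over the vertices by its own independence.\<close>

lemma prob_rectangles:
  assumes J: "finite J" "J \<noteq> {}" "J \<subseteq> vertices" and B: "\<And>v. v \<in> J \<Longrightarrow> B v \<subseteq> {1..q}"
  shows "prob (\<Inter>v\<in>J. (X v -` A v \<inter> space M) \<inter> (Y v -` B v \<inter> space M)) =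
    (\<Prod>v\<in>J. prob (X v -` A v \<inter> space M) * prob (Y v -` B v \<inter> space M))"
proof -
  let ?A = "{f \<in> space (PiM vertices (\<lambda>_. count_space (UNIV :: symbol set))). \<forall>v\<in>J. f v \<in> A v}"
  let ?B = "{f \<in> space (PiM vertices (\<lambda>_. count_space {1..q})). \<forall>v\<in>J. f v \<in> B v}"
  have A: "?A \<in> sets (PiM vertices (\<lambda>_. count_space UNIV))"
    by (rule sets_PiM_cylinder[OF J]) simp
  have B': "?B \<in> sets (PiM vertices (\<lambda>_. count_space {1..q}))"
    by (rule sets_PiM_cylinder[OF J]) (use B in simp)
  note XA = cylinder_vimage[of J vertices X M "\<lambda>_. count_space UNIV", OF J(2,3) measurable_X]
  note YB = cylinder_vimage[of J vertices Y M "\<lambda>_. count_space {1..q}", OF J(2,3) measurable_Y]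
  have "prob (\<Inter>v\<in>J. (X v -` A v \<inter> space M) \<inter> (Y v -` B v \<inter> space M)) =
      prob ((\<Inter>v\<in>J. X v -` A v \<inter> space M) \<inter> (\<Inter>v\<in>J. Y v -` B v \<inter> space M))"
    by (subst INT_Int_distrib) (rule refl)
  also have "\<dots> = prob (\<Inter>v\<in>J. X v -` A v \<inter> space M) * prob (\<Inter>v\<in>J. Y v -` B v \<inter> space M)"
  proof (rule indep_setD[OF indep_X_Y])
    show "(\<Inter>v\<in>J. X v -` A v \<inter> space M) \<in> {(\<lambda>\<omega>. \<lambda>v\<in>vertices. X v \<omega>) -` A \<inter> space M |A.
        A \<in> sets (PiM vertices (\<lambda>_. count_space UNIV))}"
      by (rule CollectI, rule exI, rule conjI, rule XA, assumption, rule A)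
    show "(\<Inter>v\<in>J. Y v -` B v \<inter> space M) \<in> {(\<lambda>\<omega>. \<lambda>v\<in>vertices. Y v \<omega>) -` B \<inter> space M |B.
        B \<in> sets (PiM vertices (\<lambda>_. count_space {1..q}))}"
      by (rule CollectI, rule exI, rule conjI, rule YB, assumption, rule B')
  qed
  also have "\<dots> = (\<Prod>v\<in>J. prob (X v -` A v \<inter> space M)) * (\<Prod>v\<in>J. prob (Y v -` B v \<inter> space M))"
    using indep_varsD[OF indep_X, of J A] indep_varsD[OF indep_Y, of J B] J B by simp
  finally show ?thesis
    by (simp only: prod.distrib)
qed

lemma measurable_XY: "v \<in> vertices \<Longrightarrow> (\<lambda>\<omega>. (X v \<omega>, Y v \<omega>)) \<in> measurable M (count_space UNIV)"
proof -
  assume v: "v \<in> vertices"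
  have "Y v \<in> measurable M (count_space UNIV)"
    using measurable_compose[OF measurable_Y[OF v], of "\<lambda>x. x" "count_space UNIV"] by simp
  from measurable_Pair[OF measurable_X[OF v] this] show ?thesis
    by (simp only: pair_measure_countable countableI_type UNIV_Times_UNIV)
qed

text \<open>Rectangles built from a symbol event and a color event are closed under intersection and
  satisfy the product formula, so independence extends to the sigma algebras that they
  generate.\<close>

lemma indep_XY: "indep_vars (\<lambda>_. count_space UNIV) (\<lambda>v \<omega>. (X v \<omega>, Y v \<omega>)) vertices"
  unfolding indep_vars_def2
proof (intro conjI ballI measurable_XY)
  let ?G = "\<lambda>v. {(X v -` A \<inter> space M) \<inter> (Y v -` B \<inter> space M) | A B. B \<subseteq> {1..q}}"
  have "indep_sets ?G vertices"
  proof (rule indep_setsI)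
    show "?G v \<subseteq> events" if "v \<in> vertices" for v
      using measurable_X[OF that] measurable_Y[OF that] by (auto intro!: sets.Int measurable_sets)
  next
    fix A J assume J: "J \<noteq> {}" "J \<subseteq> vertices" "finite J" and "\<forall>v\<in>J. A v \<in> ?G v"
    then have "\<forall>v\<in>J. \<exists>B C. A v = (X v -` B \<inter> space M) \<inter> (Y v -` C \<inter> space M) \<and> C \<subseteq> {1..q}"
      by blast
    then obtain B C where BC: "\<And>v. v \<in> J \<Longrightarrow> A v = (X v -` B v \<inter> space M) \<inter> (Y v -` C v \<inter> space M)"
        "\<And>v. v \<in> J \<Longrightarrow> C v \<subseteq> {1..q}"
      by metis
    \<comment> \<open>The one-vertex case splits each factor \<open>prob (A v)\<close>, after which
      both sides are the same product.\<close>
    have "prob (A v) = prob (X v -` B v \<inter> space M) * prob (Y v -` C v \<inter> space M)" if "v \<in> J" for v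
      using prob_rectangles[of "{v}" C B] BC(2)[OF that] J(2) that
      unfolding BC(1)[OF that] by (simp add: subsetD)
    then have "(\<Prod>v\<in>J. prob (A v)) = (\<Prod>v\<in>J. prob (X v -` B v \<inter> space M) * prob (Y v -` C v \<inter> space M))"
      by (rule prod.cong[OF refl])
    moreover have "(\<Inter>v\<in>J. A v) = (\<Inter>v\<in>J. (X v -` B v \<inter> space M) \<inter> (Y v -` C v \<inter> space M))"
      by (rule INF_cong[OF refl BC(1)])
    ultimately show "prob (\<Inter>v\<in>J. A v) = (\<Prod>v\<in>J. prob (A v))"
      using prob_rectangles[OF J(3,1,2) BC(2), where A = B] by (simp only:)
  qed
  then have "indep_sets (\<lambda>v. sigma_sets (space M) (?G v)) vertices"
  proof (rule indep_sets_sigma)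
    show "Int_stable (?G v)" for v
    proof (rule Int_stableI)
      fix a b assume "a \<in> ?G v" "b \<in> ?G v"
      then obtain A B C D where "a = (X v -` A \<inter> space M) \<inter> (Y v -` B \<inter> space M)" "B \<subseteq> {1..q}"
          "b = (X v -` C \<inter> space M) \<inter> (Y v -` D \<inter> space M)"
        by blast
      then have "a \<inter> b = (X v -` (A \<inter> C) \<inter> space M) \<inter> (Y v -` (B \<inter> D) \<inter> space M)" "B \<inter> D \<subseteq> {1..q}"
        by auto
      then show "a \<inter> b \<in> ?G v"
        by blast
    qed
  qed
  then show "indep_sets (\<lambda>v. {(\<lambda>\<omega>. (X v \<omega>, Y v \<omega>)) -` A \<inter> space M |A. A \<in> sets (count_space UNIV)}) vertices"
  proof (rule indep_sets_mono_sets, safe)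
    fix v A assume v: "v \<in> vertices"
    \<comment> \<open>The colors stay in \<open>{1..q}\<close>, so the preimage is a countable union
      of rectangles with one-point sides.\<close>
    have "(\<lambda>\<omega>. (X v \<omega>, Y v \<omega>)) -` A \<inter> space M =
        (\<Union>(s, y)\<in>A \<inter> UNIV \<times> {1..q}. (X v -` {s} \<inter> space M) \<inter> (Y v -` {y} \<inter> space M))"
      using Y_range[OF v] by auto
    also have "\<dots> \<in> sigma_sets (space M) (?G v)"
    proof (rule sigma_sets_UNION)
      have "countable (A \<inter> UNIV \<times> {1..q})"
        by (intro countable_finite finite_Int) auto
      then show "countable ((\<lambda>(s, y). (X v -` {s} \<inter> space M) \<inter> (Y v -` {y} \<inter> space M)) ` (A \<inter> UNIV \<times> {1..q}))"
        by simp
    next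
      fix E assume "E \<in> (\<lambda>(s, y). (X v -` {s} \<inter> space M) \<inter> (Y v -` {y} \<inter> space M)) ` (A \<inter> UNIV \<times> {1..q})"
      then obtain s y where "E = (X v -` {s} \<inter> space M) \<inter> (Y v -` {y} \<inter> space M)" "y \<in> {1..q}"
        by auto
      then have "E \<in> ?G v"
        by (intro CollectI exI[of _ "{s}"] exI[of _ "{y}"]) simp
      then show "E \<in> sigma_sets (space M) (?G v)"
        by (rule sigma_sets.Basic)
    qed
    finally show "(\<lambda>\<omega>. (X v \<omega>, Y v \<omega>)) -` A \<inter> space M \<in> sigma_sets (space M) (?G v)" .
  qed
qed

lemma expectation_XY:
  fixes h :: "symbol \<Rightarrow> nat \<Rightarrow> complex"
  assumes v: "v \<in> vertices"
  shows "expectation (\<lambda>\<omega>. h (X v \<omega>) (Y v \<omega>)) =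
    (\<Sum>s\<in>{NW, NE, NWNE, Odot}. \<Sum>y\<in>{1..q}. of_real (prob {\<omega> \<in> space M. X v \<omega> = s} / q) * h s y)"
proof -
  let ?S = "{NW, NE, NWNE, Odot}"
  let ?E = "\<lambda>s y. (X v -` {s} \<inter> space M) \<inter> (Y v -` {y} \<inter> space M)"
  have E: "?E s y \<in> events" if "y \<in> {1..q}" for s y
    by (intro sets.Int measurable_sets[OF measurable_X[OF v]] measurable_sets[OF measurable_Y[OF v]])
      (use that in auto)
  have Y: "prob (Y v -` {y} \<inter> space M) = 1 / q" if "y \<in> {1..q}" for y
  proof -
    have "prob (Y v -` {y} \<inter> space M) = measure (distr M (count_space {1..q}) (Y v)) {y}"
      using that by (subst measure_distr[OF measurable_Y[OF v]]) auto
    also have "\<dots> = 1 / q"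
      unfolding distr_Y[OF v] using that by (simp add: measure_uniform_count_measure)
    finally show ?thesis .
  qed
  have S: "s \<in> ?S" for s by (cases s) auto
  have "h (X v \<omega>) (Y v \<omega>) = (\<Sum>s\<in>?S. \<Sum>y\<in>{1..q}. indicator (?E s y) \<omega> *\<^sub>R h s y)"
    if \<omega>: "\<omega> \<in> space M" for \<omega>
  proof -
    have "(\<Sum>s\<in>?S. \<Sum>y\<in>{1..q}. indicator (?E s y) \<omega> *\<^sub>R h s y) =
        (\<Sum>s\<in>?S. \<Sum>y\<in>{1..q}. if y = Y v \<omega> then if s = X v \<omega> then h s y else 0 else 0)"
      by (intro sum.cong refl) (use \<omega> in \<open>simp add: indicator_def\<close>)
    also have "\<dots> = (\<Sum>s\<in>?S. if s = X v \<omega> then h s (Y v \<omega>) else 0)"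
      using Y_range[OF v \<omega>] by (simp only: sum.delta finite_atLeastAtMost if_True)
    also have "\<dots> = h (X v \<omega>) (Y v \<omega>)"
      using S by (simp only: sum.delta finite_insert finite.emptyI if_True)
    finally show ?thesis ..
  qed
  then have "expectation (\<lambda>\<omega>. h (X v \<omega>) (Y v \<omega>)) =
      expectation (\<lambda>\<omega>. \<Sum>s\<in>?S. \<Sum>y\<in>{1..q}. indicator (?E s y) \<omega> *\<^sub>R h s y)"
    by (rule Bochner_Integration.integral_cong[OF refl])
  also have "\<dots> = (\<Sum>s\<in>?S. \<Sum>y\<in>{1..q}. prob (?E s y) *\<^sub>R h s y)"
  proof -
    have int: "integrable M (\<lambda>\<omega>. indicator (?E s y) \<omega> *\<^sub>R h s y)" if "y \<in> {1..q}" for s y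
      using E[OF that, of s] by (intro integrable_scaleR_left integrable_real_indicator) (auto simp: emeasure_eq_measure)
    have "expectation (\<lambda>\<omega>. \<Sum>s\<in>?S. \<Sum>y\<in>{1..q}. indicator (?E s y) \<omega> *\<^sub>R h s y) =
        (\<Sum>s\<in>?S. \<Sum>y\<in>{1..q}. expectation (\<lambda>\<omega>. indicator (?E s y) \<omega> *\<^sub>R h s y))"
      by (subst Bochner_Integration.integral_sum, rule Bochner_Integration.integrable_sum, erule int,
          rule sum.cong[OF refl], rule Bochner_Integration.integral_sum, erule int)
    also have "\<dots> = (\<Sum>s\<in>?S. \<Sum>y\<in>{1..q}. prob (?E s y) *\<^sub>R h s y)"
      using E by (intro sum.cong refl) (subst integral_scaleR_left, auto intro!: integrable_real_indicator simp: emeasure_eq_measure)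
    finally show ?thesis .
  qed
  also have "\<dots> = (\<Sum>s\<in>?S. \<Sum>y\<in>{1..q}. of_real (prob {\<omega> \<in> space M. X v \<omega> = s} / q) * h s y)"
  proof (intro sum.cong refl)
    fix s y assume y: "y \<in> {1..q}"
    have "X v -` {s} \<inter> space M = {\<omega> \<in> space M. X v \<omega> = s}" by auto
    then show "prob (?E s y) *\<^sub>R h s y = of_real (prob {\<omega> \<in> space M. X v \<omega> = s} / q) * h s y"
      using prob_rectangles[of "{v}" "\<lambda>_. {y}" "\<lambda>_. {s}"] v y Y by (auto simp: scaleR_conv_of_real)
  qed
  finally show ?thesis .
qed

end

section \<open>One step of the process\<close>

lemma (in finite_measure) wiener_bound_integrable:
  assumes "wiener_bound q w f" and Z: "\<And>j. (\<lambda>\<omega>. Z \<omega> j) \<in> measurable M (count_space UNIV)"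
  shows "integrable M (\<lambda>\<omega>. f (Z \<omega>))"
  using assms(1)
proof induction
  case (char J a)
  have "(\<lambda>\<omega>. config_char q J a (Z \<omega>)) \<in> borel_measurable M"
    unfolding config_char_def
    by (intro borel_measurable_prod measurable_compose[OF Z]) simp
  then show ?case
    by (intro integrable_const_bound[where B = 1]) auto
next
  case (scale w f c)
  from scale.IH show ?case by (intro integrable_mult_right)
next
  case (add w f w' g)
  from add.IH show ?case by (rule Bochner_Integration.integrable_add)
qed

text \<open>The difference of the two integrals is linear in \<open>f\<close>. A bound
  \<open>B\<close> that is uniform over all characters therefore passes to \<open>f\<close> at the
  cost of its total Fourier mass.\<close>

lemma (in finite_measure) wiener_bound_diff_le:
  assumes "wiener_bound q w f"
    and Z: "\<And>j. (\<lambda>\<omega>. Z \<omega> j) \<in> measurable M (count_space UNIV)"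
    and Z': "\<And>j. (\<lambda>\<omega>. Z' \<omega> j) \<in> measurable M (count_space UNIV)"
    and B: "\<And>J a. finite J \<Longrightarrow>
      norm ((\<integral>\<omega>. config_char q J a (Z \<omega>) \<partial>M) - (\<integral>\<omega>. config_char q J a (Z' \<omega>) \<partial>M)) \<le> B"
  shows "norm ((\<integral>\<omega>. f (Z \<omega>) \<partial>M) - (\<integral>\<omega>. f (Z' \<omega>) \<partial>M)) \<le> w * B"
  using assms(1)
proof induction
  case (char J a)
  then show ?case using B by simp
next
  case (scale w f c)
  have "(\<integral>\<omega>. c * f (Z \<omega>) \<partial>M) - (\<integral>\<omega>. c * f (Z' \<omega>) \<partial>M) = c * ((\<integral>\<omega>. f (Z \<omega>) \<partial>M) - (\<integral>\<omega>. f (Z' \<omega>) \<partial>M))"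
    by (simp add: right_diff_distrib)
  then show ?case
    using mult_left_mono[OF scale.IH, of "norm c"] by (simp add: norm_mult mult.assoc)
next
  case (add w f w' g)
  note int = wiener_bound_integrable[OF add.hyps(1) Z] wiener_bound_integrable[OF add.hyps(2) Z]
    wiener_bound_integrable[OF add.hyps(1) Z'] wiener_bound_integrable[OF add.hyps(2) Z']
  have "(\<integral>\<omega>. f (Z \<omega>) + g (Z \<omega>) \<partial>M) - (\<integral>\<omega>. f (Z' \<omega>) + g (Z' \<omega>) \<partial>M) =
      ((\<integral>\<omega>. f (Z \<omega>) \<partial>M) - (\<integral>\<omega>. f (Z' \<omega>) \<partial>M)) + ((\<integral>\<omega>. g (Z \<omega>) \<partial>M) - (\<integral>\<omega>. g (Z' \<omega>) \<partial>M))"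
    using int by simp
  also have "norm \<dots> \<le> w * B + w' * B"
    by (rule norm_triangle_mono) (fact add.IH)+
  finally show ?case
    by (simp add: distrib_right)
qed

text \<open>Conditioning on a finite window as a finite sum: the only surviving pattern is
  \<open>restrict Z R\<close>, which \<open>g\<close> cannot tell from \<open>Z\<close>.\<close>

lemma sum_of_bool_window:
  fixes g :: "(int \<Rightarrow> nat) \<Rightarrow> complex"
  assumes R: "finite R" and Z: "\<And>i. i \<in> R \<Longrightarrow> Z i \<in> {1..q}"
    and g: "\<And>z. (\<And>i. i \<in> R \<Longrightarrow> z i = Z i) \<Longrightarrow> g z = g Z"
  shows "g Z = (\<Sum>z\<in>PiE R (\<lambda>_. {1..q}). of_bool (\<forall>i\<in>R. Z i = z i) * g z)"
proof -
  have "(\<Sum>z\<in>PiE R (\<lambda>_. {1..q}). of_bool (\<forall>i\<in>R. Z i = z i) * g z) =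
      (\<Sum>z\<in>PiE R (\<lambda>_. {1..q}). if z = restrict Z R then g z else 0)"
  proof (intro sum.cong refl)
    fix z assume z: "z \<in> PiE R (\<lambda>_. {1..q})"
    have "(\<forall>i\<in>R. Z i = z i) \<longleftrightarrow> z = restrict Z R"
    proof
      assume "\<forall>i\<in>R. Z i = z i"
      then show "z = restrict Z R"
        by (intro PiE_ext[OF z restrict_PiE[THEN iffD2]]) (use Z in auto)
    qed auto
    then show "of_bool (\<forall>i\<in>R. Z i = z i) * g z = (if z = restrict Z R then g z else 0)"
      by simp
  qed
  also have "\<dots> = g (restrict Z R)"
    using R Z by (subst sum.delta) (auto simp: finite_PiE simp del: atLeastAtMost_iff)
  also have "\<dots> = g Z"
    by (rule g) simp
  finally show ?thesis ..
qed

context symbols_and_colors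
begin

lemma color_process_range:
  assumes "z0 \<in> configs q" "\<omega> \<in> space M"
  shows "color_process X Y z0 n \<omega> j \<in> {1..q}"
proof (induction n arbitrary: j)
  case 0
  show ?case using assms(1) by (simp only: color_process_0) (auto simp: configs_def)
next
  case (Suc n)
  show ?case
    using Suc.IH[of "j - 1"] Suc.IH[of j] Y_range[OF row_vertex_in_vertices assms(2), of "Suc n" j]
    unfolding color_process_Suc next_color_def by (auto split: symbol.split)
qed

lemma measurable_color_process:
  "(\<lambda>\<omega>. color_process X Y z0 n \<omega> j) \<in> measurable M (count_space UNIV)"
proof (induction n arbitrary: j)
  case 0
  show ?case by (simp add: color_process_0)
next
  case (Suc n)
  let ?Z = "\<lambda>\<omega>. color_process X Y z0 n \<omega>" and ?v = "row_vertex (Suc n) j"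
  have W: "(\<lambda>\<omega>. (X ?v \<omega>, Y ?v \<omega>)) \<in> measurable M (count_space UNIV)"
    by (rule measurable_XY) simp
  have "(\<lambda>\<omega>. next_color (fst (X ?v \<omega>, Y ?v \<omega>)) (snd (X ?v \<omega>, Y ?v \<omega>)) (?Z \<omega> (j - 1)) (?Z \<omega> j))
      \<in> measurable M (count_space UNIV)"
    by (rule measurable_compose_countable[where g = "\<lambda>\<omega>. (X ?v \<omega>, Y ?v \<omega>)" and
          f = "\<lambda>w \<omega>. next_color (fst w) (snd w) (?Z \<omega> (j - 1)) (?Z \<omega> j)", OF _ W],
        rule measurable_compose_countable[OF _ Suc.IH[of "j - 1"], where
          f = "\<lambda>c \<omega>. next_color (fst w) (snd w) c (?Z \<omega> j)" for w],
        rule measurable_compose_countable[OF _ Suc.IH[of j], where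
          f = "\<lambda>c \<omega>. next_color (fst w) (snd w) d c" for w d]) simp
  then show ?case
    by (simp add: color_process_Suc)
qed

text \<open>The color symmetry enters here: \<open>\<sigma>\<close> preserves the uniform law and,
  being injective, preserves whether \<open>l = r\<close>. Permuting after the update thus gives the
  same kernel at permuted upper colors.\<close>

lemma expectation_next_color:
  assumes \<sigma>: "\<sigma> permutes {1..q}" and lr: "l \<in> {1..q}" "r \<in> {1..q}" and v: "v \<in> vertices"
  shows "expectation (\<lambda>\<omega>. color_char q a (\<sigma> (next_color (X v \<omega>) (Y v \<omega>) l r))) =
    dual_kernel q \<delta> \<epsilon> a (\<sigma> l) (\<sigma> r)"
proof (cases "int q dvd a")
  case True
  then show ?thesis
    by (simp add: dual_kernel_def color_char_dvd[OF q_pos] prob_space)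
next
  case False
  have "(\<Sum>y\<in>{1..q}. color_char q a (\<sigma> y)) = (\<Sum>y\<in>{1..q}. color_char q a y)"
    using sum.permute[OF \<sigma>, of "color_char q a"] by (simp add: comp_def)
  then have 0: "(\<Sum>y\<in>{1..q}. color_char q a (\<sigma> y)) = 0"
    using sum_color_char_colors[OF q_pos False] by simp
  \<comment> \<open>Averaging over the fresh color first kills every case in which that color is
    used.\<close>
  have sum: "(\<Sum>y\<in>{1..q}. of_real (p / q) * color_char q a (\<sigma> (next_color s y l r))) =
      of_real p * (case s of NW \<Rightarrow> color_char q a (\<sigma> l) | NE \<Rightarrow> color_char q a (\<sigma> r)
        | NWNE \<Rightarrow> (if l = r then color_char q a (\<sigma> r) else 0) | Odot \<Rightarrow> 0)" for p s
    unfolding sum_distrib_left[symmetric]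
    using 0 q_pos by (cases s) (auto simp: next_color_def)
  have \<sigma>lr: "\<sigma> l \<in> {1..q}" "\<sigma> r \<in> {1..q}" "\<sigma> l = \<sigma> r \<longleftrightarrow> l = r"
    using lr permutes_in_image[OF \<sigma>] permutes_inj[OF \<sigma>] by (auto simp: inj_eq)
  show ?thesis
    unfolding expectation_XY[OF v, of "\<lambda>s y. color_char q a (\<sigma> (next_color s y l r))"] sum
    using False color_char_delta[OF \<sigma>lr(1,2), of a] \<sigma>lr(3) q_pos
    by (simp add: dual_kernel_def prob_NW[OF v] prob_NE[OF v] prob_NWNE[OF v] prob_Odot[OF v])
qed

text \<open>Row \<open>n\<close> is a function of the half plane above, each new color a function of
  its own vertex in the next row once the upper colors are frozen to \<open>z\<close>. These blocks
  are disjoint, so the expectation factors; this is conditional independence without conditional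
  expectations.\<close>

lemma window_step:
  fixes a :: "int \<Rightarrow> int" and z0 z :: "int \<Rightarrow> nat" and n :: nat
  assumes \<sigma>: "\<sigma> permutes {1..q}" and J: "finite J"
    and z: "\<And>j. j \<in> J \<Longrightarrow> z (j - 1) \<in> {1..q} \<and> z j \<in> {1..q}" and R: "finite R"
  defines "E \<equiv> \<lambda>\<omega>. of_bool (\<forall>i\<in>R. color_process X Y z0 n \<omega> i = z i) :: complex"
    and "C \<equiv> \<lambda>j \<omega>. color_char q (a j)
      (\<sigma> (next_color (X (row_vertex (Suc n) j) \<omega>) (Y (row_vertex (Suc n) j) \<omega>) (z (j - 1)) (z j)))"
  shows "integrable M E"
    and "integrable M (\<lambda>\<omega>. E \<omega> * (\<Prod>j\<in>J. C j \<omega>))"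
    and "expectation (\<lambda>\<omega>. E \<omega> * (\<Prod>j\<in>J. C j \<omega>)) =
      expectation E * (\<Prod>j\<in>J. dual_kernel q \<delta> \<epsilon> (a j) (\<sigma> (z (j - 1))) (\<sigma> (z j)))"
proof -
  let ?N = "\<lambda>_. count_space (UNIV :: (symbol \<times> nat) set)"
  define W where "W = (\<lambda>v \<omega>. (X v \<omega>, Y v \<omega>))"
  \<comment> \<open>\<open>None\<close> stands for the past, \<open>Some j\<close> for the single
    vertex at position \<open>j\<close> of row \<open>n + 1\<close>.\<close>
  define K where "K = (\<lambda>k. case k of None \<Rightarrow> upper_vertices n | Some j \<Rightarrow> {row_vertex (Suc n) j})"
  define L where "L = insert None (Some ` J)"
  define \<phi> :: "int option \<Rightarrow> (int \<times> int \<Rightarrow> symbol \<times> nat) \<Rightarrow> complex" where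
    "\<phi> = (\<lambda>k f. case k of
        None \<Rightarrow> of_bool (\<forall>i\<in>R. row_color (\<lambda>v. fst (f v)) (\<lambda>v. snd (f v)) z0 n (2 * i - int n) = z i)
      | Some j \<Rightarrow> color_char q (a j) (\<sigma> (next_color (fst (f (row_vertex (Suc n) j)))
            (snd (f (row_vertex (Suc n) j))) (z (j - 1)) (z j))))"
  have indep: "indep_vars (\<lambda>k. PiM (K k) ?N) (\<lambda>k \<omega>. restrict (\<lambda>v. W v \<omega>) (K k)) L"
  proof (rule indep_vars_restrict)
    show "indep_vars ?N W vertices"
      unfolding W_def by (rule indep_XY)
    show "K k \<subseteq> vertices" for k
      by (auto simp: K_def upper_vertices_def vertices_def row_vertex_def split: option.split)
    show "disjoint_family_on K L"
      by (auto simp: disjoint_family_on_def K_def L_def upper_vertices_def row_vertex_def split: option.split)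
  qed
  have \<phi>: "\<phi> k \<in> borel_measurable (PiM (K k) ?N)" for k
  proof (cases k)
    case None
    have row: "(\<lambda>f. row_color (\<lambda>v. fst (f v)) (\<lambda>v. snd (f v)) z0 n (2 * i - int n))
        \<in> measurable (PiM (upper_vertices n) ?N) (count_space UNIV)" for i
      by (rule measurable_row_color) auto
    have "Measurable.pred (PiM (upper_vertices n) ?N)
        (\<lambda>f. \<forall>i\<in>R. row_color (\<lambda>v. fst (f v)) (\<lambda>v. snd (f v)) z0 n (2 * i - int n) = z i)"
      by (rule pred_intros_finite(3)[OF R], rule measurable_compose[OF row]) simp
    then have "(\<lambda>f. of_bool (\<forall>i\<in>R. row_color (\<lambda>v. fst (f v)) (\<lambda>v. snd (f v)) z0 n (2 * i - int n) = z i) :: complex)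
        \<in> borel_measurable (PiM (upper_vertices n) ?N)"
      by (rule measurable_compose) simp
    then show ?thesis
      by (simp add: \<phi>_def K_def None)
  next
    case (Some j)
    have "(\<lambda>f. f (row_vertex (Suc n) j)) \<in> measurable (PiM {row_vertex (Suc n) j} ?N) (count_space UNIV)"
      by (rule measurable_component_singleton) simp
    from measurable_compose[OF this, where g = "\<lambda>w. color_char q (a j) (\<sigma> (next_color (fst w) (snd w) (z (j - 1)) (z j)))"]
    show ?thesis
      by (simp add: \<phi>_def K_def Some)
  qed
  have ind: "indep_vars (\<lambda>_. borel) (\<lambda>k \<omega>. \<phi> k (restrict (\<lambda>v. W v \<omega>) (K k))) L"
    by (rule indep_vars_compose2[OF indep \<phi>])
  \<comment> \<open>Restricting the symbols and colors to the half plane does no harm, since the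
    recursion for row \<open>n\<close> never leaves it.\<close>
  have None_eq: "\<phi> None (restrict (\<lambda>v. W v \<omega>) (K None)) = E \<omega>" for \<omega>
  proof -
    have "row_color (\<lambda>v. fst (restrict (\<lambda>v. W v \<omega>) (upper_vertices n) v))
        (\<lambda>v. snd (restrict (\<lambda>v. W v \<omega>) (upper_vertices n) v)) z0 n (2 * i - int n) =
      color_process X Y z0 n \<omega> i" for i
      unfolding color_process_def
      by (rule row_color_cong[where n = n]) (auto simp: W_def)
    then show ?thesis
      by (simp add: \<phi>_def K_def E_def)
  qed
  have Some_eq: "\<phi> (Some j) (restrict (\<lambda>v. W v \<omega>) (K (Some j))) = C j \<omega>" for j \<omega>
    by (simp add: \<phi>_def K_def C_def W_def)
  have prod_eq: "(\<Prod>k\<in>L. F k) = F None * (\<Prod>j\<in>J. F (Some j))" for F :: "int option \<Rightarrow> complex"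
    using J unfolding L_def by (subst prod.insert) (auto simp: prod.reindex)
  have int: "integrable M (\<lambda>\<omega>. \<phi> k (restrict (\<lambda>v. W v \<omega>) (K k)))" if "k \<in> L" for k
  proof (rule integrable_const_bound[where B = 1])
    show "(\<lambda>\<omega>. \<phi> k (restrict (\<lambda>v. W v \<omega>) (K k))) \<in> borel_measurable M"
      using ind that by (auto simp: indep_vars_def)
  qed (auto simp: \<phi>_def split: option.split)
  show "integrable M E"
    using int[of None] by (simp add: None_eq L_def)
  have fin: "finite L"
    using J by (simp add: L_def)
  show "integrable M (\<lambda>\<omega>. E \<omega> * (\<Prod>j\<in>J. C j \<omega>))"
    using indep_vars_integrable[OF fin ind int] by (simp add: prod_eq None_eq Some_eq)
  have "expectation (\<lambda>\<omega>. E \<omega> * (\<Prod>j\<in>J. C j \<omega>)) = expectation E * (\<Prod>j\<in>J. expectation (C j))"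
    using indep_vars_lebesgue_integral[OF fin ind int] by (simp add: prod_eq None_eq Some_eq)
  also have "(\<Prod>j\<in>J. expectation (C j)) =
      (\<Prod>j\<in>J. dual_kernel q \<delta> \<epsilon> (a j) (\<sigma> (z (j - 1))) (\<sigma> (z j)))"
    unfolding C_def by (intro prod.cong refl expectation_next_color[OF \<sigma>]) (use z in auto)
  finally show "expectation (\<lambda>\<omega>. E \<omega> * (\<Prod>j\<in>J. C j \<omega>)) =
      expectation E * (\<Prod>j\<in>J. dual_kernel q \<delta> \<epsilon> (a j) (\<sigma> (z (j - 1))) (\<sigma> (z j)))" .
qed

text \<open>Given row \<open>n\<close>, the new colors are independent and each character averages
  to its dual kernel. The conditioning is a sum over the finitely many patterns of row
  \<open>n\<close> on a window.\<close>

lemma expectation_config_char_Suc: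
  fixes a :: "int \<Rightarrow> int"
  assumes \<sigma>: "\<sigma> permutes {1..q}" and J: "finite J" and z0: "z0 \<in> configs q"
  shows "expectation (\<lambda>\<omega>. config_char q J a (\<lambda>j. \<sigma> (color_process X Y z0 (Suc n) \<omega> j))) =
    expectation (\<lambda>\<omega>. \<Prod>j\<in>J. dual_kernel q \<delta> \<epsilon> (a j)
      (\<sigma> (color_process X Y z0 n \<omega> (j - 1))) (\<sigma> (color_process X Y z0 n \<omega> j)))"
proof -
  \<comment> \<open>The window holds the upper neighbors \<open>j - 1\<close> and \<open>j\<close>
    of every position in \<open>J\<close>.\<close>
  define R where "R = J \<union> (\<lambda>j. j - 1) ` J"
  define Q where "Q = PiE R (\<lambda>_. {1..q})"
  let ?Z = "color_process X Y z0 n"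
  let ?E = "\<lambda>z \<omega>. of_bool (\<forall>i\<in>R. ?Z \<omega> i = z i) :: complex"
  define G where "G = (\<lambda>\<omega> z. \<Prod>j\<in>J. color_char q (a j)
    (\<sigma> (next_color (X (row_vertex (Suc n) j) \<omega>) (Y (row_vertex (Suc n) j) \<omega>) (z (j - 1)) (z j))))"
  define H where "H = (\<lambda>z. \<Prod>j\<in>J. dual_kernel q \<delta> \<epsilon> (a j) (\<sigma> (z (j - 1))) (\<sigma> (z j)))"
  have R: "finite R" and JR: "\<And>j. j \<in> J \<Longrightarrow> j \<in> R \<and> j - 1 \<in> R"
    using J by (auto simp: R_def)
  have z: "z (j - 1) \<in> {1..q} \<and> z j \<in> {1..q}" if "z \<in> Q" "j \<in> J" for z j
    using that JR[of j] unfolding Q_def by blast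
  have step: "integrable M (?E z)" "integrable M (\<lambda>\<omega>. ?E z \<omega> * G \<omega> z)"
      "expectation (\<lambda>\<omega>. ?E z \<omega> * G \<omega> z) = expectation (?E z) * H z" if "z \<in> Q" for z
    unfolding G_def H_def by (rule window_step[where z = z, OF \<sigma> J z[OF that] R]; assumption)+
  have G: "G \<omega> z = G \<omega> (?Z \<omega>)" and H: "H z = H (?Z \<omega>)" if "\<And>i. i \<in> R \<Longrightarrow> z i = ?Z \<omega> i" for z \<omega>
    unfolding G_def H_def by (intro prod.cong refl; use that JR in simp)+
  have "expectation (\<lambda>\<omega>. config_char q J a (\<lambda>j. \<sigma> (color_process X Y z0 (Suc n) \<omega> j))) =
      expectation (\<lambda>\<omega>. \<Sum>z\<in>Q. ?E z \<omega> * G \<omega> z)"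
  proof (rule Bochner_Integration.integral_cong[OF refl])
    fix \<omega> assume \<omega>: "\<omega> \<in> space M"
    have "config_char q J a (\<lambda>j. \<sigma> (color_process X Y z0 (Suc n) \<omega> j)) = G \<omega> (?Z \<omega>)"
      by (simp add: config_char_def color_process_Suc G_def)
    also have "\<dots> = (\<Sum>z\<in>Q. ?E z \<omega> * G \<omega> z)"
      unfolding Q_def by (rule sum_of_bool_window[where g = "G \<omega>", OF R color_process_range[OF z0 \<omega>] G])
    finally show "config_char q J a (\<lambda>j. \<sigma> (color_process X Y z0 (Suc n) \<omega> j)) = (\<Sum>z\<in>Q. ?E z \<omega> * G \<omega> z)" .
  qed
  also have "\<dots> = (\<Sum>z\<in>Q. expectation (\<lambda>\<omega>. ?E z \<omega> * G \<omega> z))"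
    by (rule Bochner_Integration.integral_sum) (rule step(2))
  also have "\<dots> = (\<Sum>z\<in>Q. expectation (?E z) * H z)"
    by (intro sum.cong refl) (rule step(3))
  \<comment> \<open>\<open>H\<close> no longer involves the symbols of row \<open>n + 1\<close>, so
    the window expansion can be run backwards to recover the random row \<open>n\<close>.\<close>
  also have "\<dots> = expectation (\<lambda>\<omega>. \<Sum>z\<in>Q. ?E z \<omega> * H z)"
    by (subst Bochner_Integration.integral_sum) (use step(1) in auto)
  also have "\<dots> = expectation (\<lambda>\<omega>. H (?Z \<omega>))"
  proof (rule Bochner_Integration.integral_cong[OF refl])
    fix \<omega> assume \<omega>: "\<omega> \<in> space M"
    show "(\<Sum>z\<in>Q. ?E z \<omega> * H z) = H (?Z \<omega>)"
      unfolding Q_def by (rule sum_of_bool_window[where g = H, OF R color_process_range[OF z0 \<omega>] H, symmetric])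
  qed
  finally show ?thesis
    unfolding H_def .
qed

section \<open>Exponential loss of the color labels\<close>

lemma measurable_permuted:
  "(\<lambda>\<omega>. \<sigma> (color_process X Y z0 n \<omega> j) :: nat) \<in> measurable M (count_space UNIV)"
  by (rule measurable_compose[OF measurable_color_process]) simp

text \<open>One step turns a character into a combination of other characters, hence the induction
  generalizes over \<open>J\<close> and \<open>a\<close>. Trivial characters give difference 0; all
  others lose a factor \<open>1 - \<delta> * \<epsilon>\<close> per row. The constant 2 is the crude
  bound at row 0.\<close>

lemma config_char_contraction:
  assumes \<delta>\<epsilon>: "0 \<le> \<delta>" "\<delta> \<le> 1" "0 \<le> \<epsilon>" "\<epsilon> \<le> 1"
    and \<sigma>: "\<sigma> permutes {1..q}" and z0: "z0 \<in> configs q" and J: "finite J"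
  shows "norm (expectation (\<lambda>\<omega>. config_char q J a (color_process X Y z0 n \<omega>)) -
    expectation (\<lambda>\<omega>. config_char q J a (\<lambda>j. \<sigma> (color_process X Y z0 n \<omega> j)))) \<le> 2 * (1 - \<delta> * \<epsilon>) ^ n"
  using J
proof (induction n arbitrary: J a)
  case 0
  have bound: "norm (expectation (\<lambda>\<omega>. config_char q J a (Z \<omega>))) \<le> 1" for Z
  proof -
    have "norm (expectation (\<lambda>\<omega>. config_char q J a (Z \<omega>))) \<le> expectation (\<lambda>\<omega>. norm (config_char q J a (Z \<omega>)))"
      by (rule integral_norm_bound)
    then show ?thesis by (simp add: prob_space)
  qed
  have "norm (expectation (\<lambda>\<omega>. config_char q J a (color_process X Y z0 0 \<omega>)) -
    expectation (\<lambda>\<omega>. config_char q J a (\<lambda>j. \<sigma> (color_process X Y z0 0 \<omega> j)))) \<le> 1 + 1"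
    by (rule norm_triangle_le_diff[OF add_mono]) (rule bound)+
  then show ?case by simp
next
  case (Suc n)
  let ?Z = "color_process X Y z0 n"
  define c where "c = 1 - \<delta> * \<epsilon>"
  have c: "0 \<le> c" "c \<le> 1"
    using \<delta>\<epsilon> by (simp_all add: c_def mult_le_one)
  define f where "f = (\<lambda>z :: int \<Rightarrow> nat. \<Prod>j\<in>J. dual_kernel q \<delta> \<epsilon> (a j) (z (j - 1)) (z j))"
  define w where "w = (\<lambda>j. if int q dvd a j then 1 else c)"
  have f: "wiener_bound q (\<Prod>j\<in>J. w j) f"
    unfolding f_def w_def c_def
    by (intro wiener_bound_prod Suc.prems wiener_bound_dual_kernel q_pos \<delta>\<epsilon>)
  \<comment> \<open>The identity permutation covers the original process, and both expectations lead
    to the same function \<open>f\<close>.\<close>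
  have step: "norm (expectation (\<lambda>\<omega>. config_char q J a (color_process X Y z0 (Suc n) \<omega>)) -
      expectation (\<lambda>\<omega>. config_char q J a (\<lambda>j. \<sigma> (color_process X Y z0 (Suc n) \<omega> j)))) =
      norm (expectation (\<lambda>\<omega>. f (?Z \<omega>)) - expectation (\<lambda>\<omega>. f (\<lambda>j. \<sigma> (?Z \<omega> j))))"
    using expectation_config_char_Suc[OF permutes_id Suc.prems z0, of a n]
      expectation_config_char_Suc[OF \<sigma> Suc.prems z0, of a n]
    by (simp add: f_def)
  show ?case
  proof (cases "\<forall>j\<in>J. int q dvd a j")
    case True
    then have "f z = 1" for z
      by (simp add: f_def dual_kernel_def)
    then show ?thesis
      unfolding step using c by (simp add: c_def[symmetric])
  next
    case False
    then obtain i where i: "i \<in> J" "\<not> int q dvd a i" by blast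
    \<comment> \<open>One nontrivial frequency already supplies the factor \<open>c\<close>; the
      remaining factors are at most 1.\<close>
    have "(\<Prod>j\<in>J. w j) = w i * (\<Prod>j\<in>J - {i}. w j)"
      by (rule prod.remove[OF Suc.prems i(1)])
    also have "\<dots> \<le> w i * 1"
      by (intro mult_left_mono prod_le_1) (use c in \<open>auto simp: w_def\<close>)
    finally have "(\<Prod>j\<in>J. w j) \<le> c"
      using i by (simp add: w_def)
    have "norm (expectation (\<lambda>\<omega>. f (?Z \<omega>)) - expectation (\<lambda>\<omega>. f (\<lambda>j. \<sigma> (?Z \<omega> j))))
        \<le> (\<Prod>j\<in>J. w j) * (2 * c ^ n)"
      by (rule wiener_bound_diff_le[OF f measurable_color_process measurable_permuted])
        (use Suc.IH in \<open>simp add: c_def\<close>)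
    also have "\<dots> \<le> c * (2 * c ^ n)"
      by (rule mult_right_mono[OF \<open>(\<Prod>j\<in>J. w j) \<le> c\<close>]) (use c in simp)
    finally show ?thesis
      unfolding step by (simp add: c_def)
  qed
qed

text \<open>On colors, a cylinder indicator is a function with Fourier bound \<open>W\<close>, and
  \<open>W\<close> does not depend on \<open>n\<close>; the contraction then gives the bound
  \<open>2 * W * (1 - \<delta> * \<epsilon>) ^ n\<close>.\<close>

lemma prob_cylinder_diff_tendsto_0:
  assumes \<delta>\<epsilon>: "0 < \<delta>" "\<delta> \<le> 1" "0 < \<epsilon>" "\<epsilon> \<le> 1"
    and \<sigma>: "\<sigma> permutes {1..q}" and z0: "z0 \<in> configs q" and J: "finite J"
  shows "(\<lambda>n. expectation (\<lambda>\<omega>. \<Prod>j\<in>J. indicator (A j) (color_process X Y z0 n \<omega> j)) -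
    expectation (\<lambda>\<omega>. \<Prod>j\<in>J. indicator (A j) (\<sigma> (color_process X Y z0 n \<omega> j)))) \<longlonglongrightarrow> (0 :: real)"
proof -
  let ?Z = "color_process X Y z0"
  have "\<exists>w h. wiener_bound q w (\<lambda>z. h (z j)) \<and> (\<forall>c\<in>{1..q}. h c = (indicator (A j) c :: complex))" for j
    using wiener_bound_coordinate[of q j "indicator (A j)"] by metis
  then obtain w h where wh: "\<And>j. wiener_bound q (w j) (\<lambda>z. h j (z j))"
      "\<And>j c. c \<in> {1..q} \<Longrightarrow> h j c = (indicator (A j) c :: complex)"
    by metis
  define f where "f = (\<lambda>z :: int \<Rightarrow> nat. \<Prod>j\<in>J. h j (z j))"
  define W where "W = (\<Prod>j\<in>J. w j)"
  have f: "wiener_bound q W f"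
    unfolding f_def W_def by (intro wiener_bound_prod J wh)
  \<comment> \<open>\<open>h j\<close> matches the indicator only on \<open>{1..q}\<close>, where
    the permuted process stays. The cases \<open>id\<close> and \<open>\<sigma>\<close> of
    \<open>\<tau>\<close> are used below.\<close>
  have fZ: "complex_of_real (expectation (\<lambda>\<omega>. \<Prod>j\<in>J. indicator (A j) (\<tau> (?Z n \<omega> j)))) =
      expectation (\<lambda>\<omega>. f (\<lambda>j. \<tau> (?Z n \<omega> j)))" if "\<tau> permutes {1..q}" for \<tau> n
  proof -
    have "complex_of_real (expectation (\<lambda>\<omega>. \<Prod>j\<in>J. indicator (A j) (\<tau> (?Z n \<omega> j)))) =
      expectation (\<lambda>\<omega>. complex_of_real (\<Prod>j\<in>J. indicator (A j) (\<tau> (?Z n \<omega> j))))"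
      by (rule integral_complex_of_real[symmetric])
    also have "\<dots> = expectation (\<lambda>\<omega>. f (\<lambda>j. \<tau> (?Z n \<omega> j)))"
    proof (rule Bochner_Integration.integral_cong[OF refl])
      fix \<omega> assume "\<omega> \<in> space M"
      then have "\<tau> (?Z n \<omega> j) \<in> {1..q}" for j
        using color_process_range[OF z0] permutes_in_image[OF that] by blast
      then show "complex_of_real (\<Prod>j\<in>J. indicator (A j) (\<tau> (?Z n \<omega> j))) = f (\<lambda>j. \<tau> (?Z n \<omega> j))"
        by (auto simp: f_def wh(2) indicator_def of_bool_def intro!: prod.cong)
    qed
    finally show ?thesis .
  qed
  have "norm (expectation (\<lambda>\<omega>. f (?Z n \<omega>)) - expectation (\<lambda>\<omega>. f (\<lambda>j. \<sigma> (?Z n \<omega> j))))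
      \<le> W * (2 * (1 - \<delta> * \<epsilon>) ^ n)" for n
    by (rule wiener_bound_diff_le[OF f measurable_color_process measurable_permuted])
      (use config_char_contraction \<delta>\<epsilon> \<sigma> z0 in simp)
  then have "norm (complex_of_real (expectation (\<lambda>\<omega>. \<Prod>j\<in>J. indicator (A j) (?Z n \<omega> j)) -
      expectation (\<lambda>\<omega>. \<Prod>j\<in>J. indicator (A j) (\<sigma> (?Z n \<omega> j))))) \<le> W * (2 * (1 - \<delta> * \<epsilon>) ^ n)" for n
    unfolding of_real_diff fZ[OF \<sigma>] using fZ[OF permutes_id, of n] by (simp only: id_apply)
  then have bound: "norm (expectation (\<lambda>\<omega>. \<Prod>j\<in>J. indicator (A j) (?Z n \<omega> j)) -
      expectation (\<lambda>\<omega>. \<Prod>j\<in>J. indicator (A j) (\<sigma> (?Z n \<omega> j))) :: real) \<le> W * (2 * (1 - \<delta> * \<epsilon>) ^ n)" for n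
    by (simp only: norm_of_real real_norm_def)
  \<comment> \<open>Positivity of both parameters makes the base of the power strictly less than
    1.\<close>
  have "0 < \<delta> * \<epsilon>" "\<delta> * \<epsilon> \<le> 1"
    using \<delta>\<epsilon> by (simp_all add: mult_le_one)
  then have "(\<lambda>n. (1 - \<delta> * \<epsilon>) ^ n) \<longlonglongrightarrow> 0"
    by (intro LIMSEQ_power_zero) simp
  then have "(\<lambda>n. W * (2 * (1 - \<delta> * \<epsilon>) ^ n)) \<longlonglongrightarrow> 0"
    by (intro tendsto_mult_right_zero)
  then show ?thesis
    by (rule Lim_null_comparison[OF always_eventually[rule_format, OF bound]])
qed

end

section \<open>Measurability and cylinder sets in the configuration space\<close>

lemma sets_config_space:
  "sets (config_space q) = (\<inter>) (configs q) ` sets (PiM UNIV (\<lambda>_ :: int. borel :: nat measure))"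
  by (simp add: config_space_def sets_restrict_space sets_PiM_equal_borel)

lemma space_config_space: "space (config_space q) = configs q"
  by (simp add: config_space_def space_restrict_space)

text \<open>Over the countable index set of integers, the Borel sets of the product topology are the
  product sigma algebra, so coordinates suffice.\<close>

lemma measurable_into_config_space:
  assumes "\<And>j. (\<lambda>\<omega>. Z \<omega> j) \<in> measurable M (count_space UNIV)" "\<And>\<omega>. \<omega> \<in> space M \<Longrightarrow> Z \<omega> \<in> configs q"
  shows "Z \<in> measurable M (config_space q)"
  unfolding config_space_def
proof (rule measurable_restrict_space2)
  have "(\<lambda>\<omega>. Z \<omega> j) \<in> borel_measurable M" for j
    by (rule measurable_compose[OF assms(1)]) simp
  then have "(\<lambda>\<omega>. \<lambda>j\<in>UNIV. Z \<omega> j) \<in> measurable M (PiM UNIV (\<lambda>_. borel))"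
    by (intro measurable_restrict)
  then show "Z \<in> borel_measurable M"
    by (simp add: measurable_cong_sets[OF refl sets_PiM_equal_borel] restrict_def)
qed (use assms(2) in auto)

text \<open>Both measures are pushed along the inclusion into the full product space, where
  finite-dimensional cylinders determine a finite measure.\<close>

lemma config_space_measure_eqI:
  assumes \<mu>: "sets \<mu> = sets (config_space q)" "finite_measure \<mu>"
    and \<nu>: "sets \<nu> = sets (config_space q)"
    and eq: "\<And>A J. finite J \<Longrightarrow>
      emeasure \<mu> {z \<in> configs q. \<forall>j\<in>J. z j \<in> A j} = emeasure \<nu> {z \<in> configs q. \<forall>j\<in>J. z j \<in> A j}"
  shows "\<mu> = \<nu>"
proof -
  let ?N = "PiM UNIV (\<lambda>_ :: int. borel :: nat measure)"
  have id: "(\<lambda>z. z) \<in> measurable M ?N" if "sets M = sets (config_space q)" for M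
  proof -
    have "(\<lambda>z. z) \<in> measurable (config_space q) borel"
      unfolding config_space_def by (rule measurable_restrict_space1) simp
    then show ?thesis
      by (simp add: measurable_cong_sets[OF that sets_PiM_equal_borel])
  qed
  have emeasure_distr_id: "emeasure (distr M ?N (\<lambda>z. z)) B = emeasure M (B \<inter> configs q)"
    if "sets M = sets (config_space q)" "B \<in> sets ?N" for M B
  proof -
    have "space M = configs q"
      using sets_eq_imp_space_eq[OF that(1)] by (simp add: space_config_space)
    then show ?thesis
      using emeasure_distr[OF id[OF that(1)] that(2)] by simp
  qed
  have distr_eq: "distr \<mu> ?N (\<lambda>z. z) = distr \<nu> ?N (\<lambda>z. z)"
  proof (rule measure_eqI_PiM_infinite)
    show "finite_measure (distr \<mu> ?N (\<lambda>z. z))"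
      by (rule finite_measure.finite_measure_distr[OF \<mu>(2) id[OF \<mu>(1)]])
  next
    fix A :: "int \<Rightarrow> nat set" and J :: "int set"
    assume J: "finite J" "\<And>i. i \<in> J \<Longrightarrow> A i \<in> sets borel"
    let ?C = "prod_emb UNIV (\<lambda>_ :: int. borel :: nat measure) J (Pi\<^sub>E J A)"
    have C: "?C \<in> sets ?N"
      by (rule sets_PiM_I) (use J in auto)
    have "z \<in> ?C \<longleftrightarrow> (\<forall>j\<in>J. z j \<in> A j)" for z
      by (simp add: prod_emb_iff restrict_PiE_iff Pi_iff)
    then have C_eq: "?C \<inter> configs q = {z \<in> configs q. \<forall>j\<in>J. z j \<in> A j}"
      by blast
    have "emeasure (distr \<mu> ?N (\<lambda>z. z)) ?C = emeasure \<mu> (?C \<inter> configs q)"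
      by (rule emeasure_distr_id[OF \<mu>(1) C])
    also have "\<dots> = emeasure \<nu> (?C \<inter> configs q)"
      unfolding C_eq by (rule eq[OF J(1)])
    also have "\<dots> = emeasure (distr \<nu> ?N (\<lambda>z. z)) ?C"
      by (rule emeasure_distr_id[OF \<nu> C, symmetric])
    finally show "emeasure (distr \<mu> ?N (\<lambda>z. z)) ?C = emeasure (distr \<nu> ?N (\<lambda>z. z)) ?C" .
  qed simp_all
  show ?thesis
  proof (rule measure_eqI)
    show "sets \<mu> = sets \<nu>" using \<mu>(1) \<nu> by simp
    fix S assume "S \<in> sets \<mu>"
    \<comment> \<open>Each measurable set is the trace of a set in the full product, so equality of
      the pushed measures comes back to \<open>\<mu>\<close> and \<open>\<nu>\<close>.\<close>
    then have "S \<in> (\<inter>) (configs q) ` sets ?N"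
      unfolding \<mu>(1) sets_config_space .
    then obtain B where B: "B \<in> sets ?N" and S: "S = B \<inter> configs q"
      by (auto simp only: Int_commute)
    show "emeasure \<mu> S = emeasure \<nu> S"
      unfolding S emeasure_distr_id[OF \<mu>(1) B, symmetric] emeasure_distr_id[OF \<nu> B, symmetric] distr_eq ..
  qed
qed

text \<open>The coordinates are discrete, so any function of one coordinate is continuous. Cylinder
  indicators can thus be tested directly against weak convergence.\<close>

lemma continuous_on_cylinder:
  fixes g :: "int \<Rightarrow> nat \<Rightarrow> real"
  shows "continuous_on S (\<lambda>z. \<Prod>j\<in>J. g j (z j))"
proof (intro continuous_on_prod)
  fix j
  have "continuous_on UNIV (g j)"
    by simp
  moreover have "continuous_on S (\<lambda>z. z j)"
    by (rule continuous_on_product_coordinates[THEN continuous_on_subset]) simp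
  ultimately show "continuous_on S (\<lambda>z. g j (z j))"
    using continuous_on_compose2[of UNIV "g j" S "\<lambda>z. z j"] by simp
qed

section \<open>Passage to the weak limit\<close>

theorem theorem3:
  fixes M :: "'w measure"
    and X :: "int \<times> int \<Rightarrow> 'w \<Rightarrow> symbol"
    and Y :: "int \<times> int \<Rightarrow> 'w \<Rightarrow> nat"
    and \<delta> \<epsilon> :: real
    and q :: nat
    and z0 :: "int \<Rightarrow> nat"
    and \<mu> :: "(int \<Rightarrow> nat) measure"
  assumes "0 < \<delta>" "\<delta> \<le> 1"
    and "0 < \<epsilon>" "\<epsilon> \<le> 1"
    and "2 < q"
    and "symbols_and_colors M X Y \<delta> \<epsilon> q"
    and "z0 \<in> configs q"
    and "subseq_limit_law q M (color_process X Y z0) \<mu>"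
  shows "color_permutation_invariant q \<mu>"
  unfolding color_permutation_invariant_def
proof (intro allI impI)
  fix \<sigma> :: "nat \<Rightarrow> nat"
  assume \<sigma>: "\<sigma> permutes {1..q}"
  interpret symbols_and_colors M X Y \<delta> \<epsilon> q by fact
  let ?Z = "color_process X Y z0"
  obtain r :: "nat \<Rightarrow> nat" where \<mu>: "prob_space \<mu>" "sets \<mu> = sets (config_space q)"
      and r: "filterlim r at_top sequentially"
      and conv: "weak_conv_on (configs q) (\<lambda>k. distr M (config_space q) (?Z (r k))) \<mu>"
    using assms(8) unfolding subseq_limit_law_def by blast
  interpret \<mu>: prob_space \<mu> by fact
  have space_\<mu>: "space \<mu> = configs q"
    using sets_eq_imp_space_eq[OF \<mu>(2)] by (simp add: space_config_space)
  have Z: "?Z n \<in> measurable M (config_space q)" for n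
    by (rule measurable_into_config_space[OF measurable_color_process])
      (use color_process_range[OF assms(7)] in \<open>auto simp: configs_def\<close>)
  have coord: "(\<lambda>z. z j) \<in> measurable (config_space q) (count_space UNIV)" for j :: int
  proof -
    have "(\<lambda>z. z j) \<in> borel_measurable (borel :: (int \<Rightarrow> nat) measure)"
      by (rule borel_measurable_continuous_onI[OF continuous_on_product_coordinates])
    then have "(\<lambda>z. z j) \<in> measurable (config_space q) borel"
      unfolding config_space_def by (rule measurable_restrict_space1)
    then show ?thesis
      by (simp add: measurable_cong_sets[OF refl sets_borel_eq_count_space])
  qed
  note coord_\<mu> = coord[folded measurable_cong_sets[OF \<mu>(2) refl]]
  have perm: "(\<lambda>z j. \<sigma> (z j)) \<in> measurable (config_space q) (config_space q)"
    by (rule measurable_into_config_space[OF measurable_compose[OF coord]])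
      (use permutes_in_image[OF \<sigma>] in \<open>auto simp: configs_def space_config_space\<close>)
  have perm_\<mu>: "(\<lambda>z j. \<sigma> (z j)) \<in> measurable \<mu> \<mu>"
    using perm by (simp add: measurable_cong_sets[OF \<mu>(2) \<mu>(2)])
  \<comment> \<open>The bound on the factors makes the product bounded, hence an admissible test
    function.\<close>
  have limit: "(\<lambda>k. expectation (\<lambda>\<omega>. \<Prod>j\<in>J. g j (?Z (r k) \<omega> j))) \<longlonglongrightarrow> (\<integral>z. (\<Prod>j\<in>J. g j (z j)) \<partial>\<mu>)"
    if g: "\<And>j c. \<bar>g j c\<bar> \<le> 1" for J and g :: "int \<Rightarrow> nat \<Rightarrow> real"
  proof -
    let ?f = "\<lambda>z. \<Prod>j\<in>J. g j (z j)"
    have "bounded (?f ` configs q)"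
      unfolding bounded_iff
    proof (intro exI ballI)
      show "norm x \<le> 1" if "x \<in> ?f ` configs q" for x
        using that by (auto simp: abs_prod intro!: prod_le_1 g)
    qed
    then have "(\<lambda>k. \<integral>z. ?f z \<partial>distr M (config_space q) (?Z (r k))) \<longlonglongrightarrow> (\<integral>z. ?f z \<partial>\<mu>)"
      using conv continuous_on_cylinder unfolding weak_conv_on_def by blast
    moreover have "?f \<in> borel_measurable (config_space q)"
      by (intro borel_measurable_prod measurable_compose[OF coord]) simp
    ultimately show ?thesis
      by (simp add: integral_distr[OF Z])
  qed
  show "distr \<mu> \<mu> (\<lambda>z j. \<sigma> (z j)) = \<mu>"
  proof (rule config_space_measure_eqI)
    fix A :: "int \<Rightarrow> nat set" and J :: "int set"
    assume J: "finite J"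
    let ?f = "\<lambda>z. \<Prod>j\<in>J. indicator (A j) (z j) :: real"
    let ?C = "{z \<in> configs q. \<forall>j\<in>J. z j \<in> A j}"
    have C: "?C \<in> sets \<mu>"
    proof -
      have "?C = (\<Inter>j\<in>J. (\<lambda>z. z j) -` A j \<inter> space (config_space q)) \<inter> space (config_space q)"
        by (auto simp: space_config_space)
      also have "\<dots> \<in> sets (config_space q)"
      proof (cases "J = {}")
        case False
        then show ?thesis
          by (intro sets.Int sets.finite_INT J measurable_sets[OF coord]) auto
      qed auto
      finally show ?thesis using \<mu>(2) by simp
    qed
    have ind: "?f z = indicator ?C z" if "z \<in> configs q" for z
    proof (cases "\<forall>j\<in>J. z j \<in> A j")
      case True
      then show ?thesis using that by simp
    next
      case False
      then obtain j where "j \<in> J" "z j \<notin> A j" by blast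
      then have "?f z = 0"
        using J by (intro prod_zero bexI[of _ j]) auto
      then show ?thesis using False by simp
    qed
    \<comment> \<open>Composing a cylinder function with \<open>\<sigma>\<close> gives another
      cylinder function, so both integrals are limits along the same \<open>r\<close>.\<close>
    have "(\<lambda>k. expectation (\<lambda>\<omega>. ?f (?Z (r k) \<omega>)) - expectation (\<lambda>\<omega>. ?f (\<lambda>j. \<sigma> (?Z (r k) \<omega> j))))
        \<longlonglongrightarrow> (\<integral>z. ?f z \<partial>\<mu>) - (\<integral>z. ?f (\<lambda>j. \<sigma> (z j)) \<partial>\<mu>)"
      by (rule tendsto_diff[OF limit limit[of "\<lambda>j c. indicator (A j) (\<sigma> c)" J]]) (simp_all add: indicator_def)
    \<comment> \<open>The difference vanishes along the full sequence, hence along \<open>r\<close>,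
      which tends to infinity.\<close>
    moreover have "(\<lambda>k. expectation (\<lambda>\<omega>. ?f (?Z (r k) \<omega>)) - expectation (\<lambda>\<omega>. ?f (\<lambda>j. \<sigma> (?Z (r k) \<omega> j))))
        \<longlonglongrightarrow> 0"
      using filterlim_compose[OF prob_cylinder_diff_tendsto_0[OF assms(1-4) \<sigma> assms(7) J, of A] r] .
    ultimately have "(\<integral>z. ?f z \<partial>\<mu>) - (\<integral>z. ?f (\<lambda>j. \<sigma> (z j)) \<partial>\<mu>) = 0"
      by (rule LIMSEQ_unique)
    moreover have integral_cylinder: "(\<integral>z. ?f z \<partial>\<nu>) = measure \<nu> ?C" if "space \<nu> = configs q" for \<nu>
    proof -
      have "(\<integral>z. ?f z \<partial>\<nu>) = (\<integral>z. indicator ?C z \<partial>\<nu>)"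
        by (rule Bochner_Integration.integral_cong[OF refl ind]) (simp only: that)
      also have "\<dots> = measure \<nu> (?C \<inter> space \<nu>)"
        by (rule Bochner_Integration.integral_indicator)
      also have "?C \<inter> space \<nu> = ?C"
        using that by auto
      finally show ?thesis .
    qed
    moreover have "(\<integral>z. ?f (\<lambda>j. \<sigma> (z j)) \<partial>\<mu>) = measure (distr \<mu> \<mu> (\<lambda>z j. \<sigma> (z j))) ?C"
    proof -
      have "?f \<in> borel_measurable \<mu>"
        by (intro borel_measurable_prod measurable_compose[OF coord_\<mu>]) simp
      then have "(\<integral>z. ?f (\<lambda>j. \<sigma> (z j)) \<partial>\<mu>) = (\<integral>z. ?f z \<partial>distr \<mu> \<mu> (\<lambda>z j. \<sigma> (z j)))"
        by (rule integral_distr[OF perm_\<mu>, symmetric])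
      also have "\<dots> = measure (distr \<mu> \<mu> (\<lambda>z j. \<sigma> (z j))) ?C"
        by (rule integral_cylinder) (simp add: space_\<mu>)
      finally show ?thesis .
    qed
    ultimately have "measure (distr \<mu> \<mu> (\<lambda>z j. \<sigma> (z j))) ?C = measure \<mu> ?C"
      using integral_cylinder[OF space_\<mu>] by linarith
    then show "emeasure (distr \<mu> \<mu> (\<lambda>z j. \<sigma> (z j))) ?C = emeasure \<mu> ?C"
      unfolding \<mu>.emeasure_eq_measure
        finite_measure.emeasure_eq_measure[OF \<mu>.finite_measure_distr[OF perm_\<mu>]] by (rule arg_cong)
  next
    show "finite_measure (distr \<mu> \<mu> (\<lambda>z j. \<sigma> (z j)))"
      by (rule \<mu>.finite_measure_distr[OF perm_\<mu>])
  qed (simp_all add: \<mu>(2))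
qed

end
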